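(* Let $\alpha > 0$ be a real number. Given three finite measures $\mu_1, \mu_2, \mu_3$ on $\mathbb{R}^2$, each absolutely continuous with respect to the Lebesgue measure, there exists a sine wave of period $\alpha$ (possibly degenerate) halving each measure, i.e. each of the two regions into which it divides the plane has exactly half of $\mu_i$ for $i=1,2,3$.
   Context: A sine wave of period $\alpha$ is the graph of a function $y = r + A\sin(2\pi x/\alpha + s)$ for real numbers $A, r, s$; it divides the plane into the region above and the region below it. A degenerate sine wave of period $\alpha$ is obtained by taking two vertical lines meeting the $x$-axis at points of the interval $[0,\alpha)$ and taking their translated copies in every interval $n\alpha + [0,\alpha)$, $n \in \mathbb{Z}$; the resulting family of vertical lines induces a chessboard (alternating) two-coloring of the plane into two regions. *)

theory Defs
  imports "HOL-Analysis.Analysis"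
begin

definition sine_wave :: "real \<Rightarrow> real \<Rightarrow> real \<Rightarrow> real \<Rightarrow> (real \<times> real) set" where
  "sine_wave \<alpha> A r s = {(x, y). y = r + A * sin (2 * pi * x / \<alpha> + s)}"

definition above_sine_wave :: "real \<Rightarrow> real \<Rightarrow> real \<Rightarrow> real \<Rightarrow> (real \<times> real) set" where
  "above_sine_wave \<alpha> A r s = {(x, y). y > r + A * sin (2 * pi * x / \<alpha> + s)}"

definition below_sine_wave :: "real \<Rightarrow> real \<Rightarrow> real \<Rightarrow> real \<Rightarrow> (real \<times> real) set" where
  "below_sine_wave \<alpha> A r s = {(x, y). y < r + A * sin (2 * pi * x / \<alpha> + s)}"

definition degenerate_sine_wave :: "real \<Rightarrow> real \<Rightarrow> real \<Rightarrow> (real \<times> real) set" where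
  "degenerate_sine_wave \<alpha> a b = (\<Union>n::int. {(x, y). x = of_int n * \<alpha> + a \<or> x = of_int n * \<alpha> + b})"

text \<open>
  For \<open>0 \<le> a < b < \<alpha>\<close> the vertical lines occur from left to right in the order
  \<open>\<dots>, n\<alpha> + a, n\<alpha> + b, (n + 1)\<alpha> + a, (n + 1)\<alpha> + b, \<dots>\<close>. The open strips between consecutive lines
  are coloured alternately: one colour class consists of the strips that start at a copy of \<open>a\<close>,
  the other of the strips that start at a copy of \<open>b\<close>.
\<close>

definition inner_strips :: "real \<Rightarrow> real \<Rightarrow> real \<Rightarrow> (real \<times> real) set" where
  "inner_strips \<alpha> a b =
     (\<Union>n::int. {(x, y). of_int n * \<alpha> + a < x \<and> x < of_int n * \<alpha> + b})"

definition outer_strips :: "real \<Rightarrow> real \<Rightarrow> real \<Rightarrow> (real \<times> real) set" where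
  "outer_strips \<alpha> a b =
     (\<Union>n::int. {(x, y). of_int n * \<alpha> + b < x \<and> x < of_int (n + 1) * \<alpha> + a})"

text \<open>
  \<open>divides \<alpha> W U V\<close>: \<open>W\<close> is a possibly degenerate sine wave of period \<open>\<alpha>\<close>, and \<open>U\<close>, \<open>V\<close> are the two
  open regions into which it divides the plane. The two lines of a degenerate wave are required to
  be distinct (\<open>a < b\<close>).
\<close>

inductive divides ::
    "real \<Rightarrow> (real \<times> real) set \<Rightarrow> (real \<times> real) set \<Rightarrow> (real \<times> real) set \<Rightarrow> bool"
  for \<alpha> :: real where
  proper: "divides \<alpha> (sine_wave \<alpha> A r s) (above_sine_wave \<alpha> A r s) (below_sine_wave \<alpha> A r s)"
| degenerate: "0 \<le> a \<Longrightarrow> a < b \<Longrightarrow> b < \<alpha> \<Longrightarrow>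
     divides \<alpha> (degenerate_sine_wave \<alpha> a b) (inner_strips \<alpha> a b) (outer_strips \<alpha> a b)"

end

theory Submission
  imports Defs "HOL-Homology.Homology"
begin

text \<open>
  For \<open>v = (a, b, c, d)\<close> on the unit sphere let \<open>h\<^sub>v(x, y) = a cos (2\<pi>x/\<alpha>) + b sin (2\<pi>x/\<alpha>) + c y + d\<close>.
  The sets where \<open>h\<^sub>v\<close> is positive and negative are the two sides of a sine wave if \<open>c \<noteq> 0\<close>, and of a
  degenerate one if \<open>c = 0\<close> and both are nonempty. The map sending \<open>v\<close> to the three differences of the
  measures of the two sides is odd, and continuous by absolute continuity, so it has a zero by the
  Borsuk-Ulam theorem. If one side is empty at the zero, then all three measures vanish.

  Borsuk-Ulam is needed only for odd maps \<open>S\<^sup>3 \<rightarrow> \<real>\<^sup>3\<close>. A map without zeros may be assumed to be a polynomial,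
  and then, after a generic linear change of coordinates, to send the circle \<open>S\<^sup>1\<close> off the third axis;
  a deformation makes its normalisation \<open>S\<^sup>3 \<rightarrow> S\<^sup>2\<close> preserve \<open>S\<^sup>1\<close> and \<open>S\<^sup>0\<close>. The restriction to \<open>S\<^sup>2\<close> has odd
  degree, since the degree of an odd map changes by an even number on passing to an invariant
  equator, but it extends over a hemisphere and therefore has degree zero.
\<close>

subsection \<open>Degrees of odd maps of spheres\<close>

text \<open>The product topology on real sequences is the topology of the function type, so
  \<open>continuous_map\<close> between spheres can be handled through
  \<open>continuous_on\<close>.\<close>

lemma nsphere_eq_top_of_set: "nsphere n = top_of_set (topspace (nsphere n))"
  by (simp add: nsphere euclidean_product_topology)

lemma continuous_map_nsphere_iff:
  "continuous_map (nsphere m) (nsphere n) f \<longleftrightarrow>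
     continuous_on (topspace (nsphere m)) f \<and> f \<in> topspace (nsphere m) \<rightarrow> topspace (nsphere n)"
  by (subst (1 2) nsphere_eq_top_of_set) (simp add: Pi_iff image_subset_iff)

lemma in_nsphere:
  "x \<in> topspace (nsphere n) \<longleftrightarrow> (\<Sum>i\<le>n. (x i)\<^sup>2) = 1 \<and> (\<forall>i>n. x i = 0)"
  by (simp add: nsphere)

text \<open>Sliding the equator over the upper hemisphere to the pole and then applying
  \<open>g\<close> contracts the restriction of \<open>g\<close> to a constant, and null-homotopic
  maps have degree zero.\<close>

lemma Brouwer_degree2_extends_hemisphere:
  assumes "continuous_map (nsphere (Suc n)) (nsphere n) g"
  shows "Brouwer_degree2 n g = 0"
proof -
  \<comment> \<open>The parameter \<open>t\<close> is the height: \<open>h\<close> shrinks the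
    equator to the parallel of radius \<open>sqrt (1 - t\<^sup>2)\<close>. It starts at the identity
    and ends at the pole.\<close>
  define h :: "real \<times> (nat \<Rightarrow> real) \<Rightarrow> nat \<Rightarrow> real" where
    "h = (\<lambda>(t, x) i. if i = Suc n then t else sqrt (1 - t\<^sup>2) * x i)"
  have g: "continuous_on (topspace (nsphere (Suc n))) g"
    "g \<in> topspace (nsphere (Suc n)) \<rightarrow> topspace (nsphere n)"
    using assms by (auto simp: continuous_map_nsphere_iff)
  have hin: "h (t, x) \<in> topspace (nsphere (Suc n))"
    if "t \<in> {0..1}" "x \<in> topspace (nsphere n)" for t x
  proof -
    have "(\<Sum>i\<le>n. (sqrt (1 - t\<^sup>2) * x i)\<^sup>2) = (1 - t\<^sup>2) * (\<Sum>i\<le>n. (x i)\<^sup>2)"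
      using that by (simp add: power_mult_distrib sum_distrib_left power_le_one)
    moreover have "(\<Sum>i\<le>n. (h (t, x) i)\<^sup>2) = (\<Sum>i\<le>n. (sqrt (1 - t\<^sup>2) * x i)\<^sup>2)"
      by (intro sum.cong) (auto simp: h_def)
    ultimately show ?thesis
      using that by (auto simp: in_nsphere h_def)
  qed
  have hc: "continuous_on ({0..1} \<times> topspace (nsphere n)) h"
  proof (rule continuous_on_coordinatewise_then_product)
    have "continuous_on UNIV (\<lambda>x::nat \<Rightarrow> real. x i)" for i
      by (rule continuous_on_product_coordinates)
    then have "continuous_on A (\<lambda>z::real \<times> (nat \<Rightarrow> real). snd z i)" for i A
      by (rule continuous_on_compose2) (auto intro: continuous_on_snd continuous_on_id)
    then have "continuous_on A (\<lambda>z::real \<times> (nat \<Rightarrow> real). sqrt (1 - (fst z)\<^sup>2) * snd z i)" for i A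
      by (intro continuous_intros)
    then show "continuous_on ({0..1} \<times> topspace (nsphere n)) (\<lambda>z. h z i)" for i
      by (cases "i = Suc n")
        (simp_all add: h_def case_prod_beta continuous_on_fst[OF continuous_on_id])
  qed
  have *: "prod_topology (top_of_set {0..1}) (nsphere n) = top_of_set ({0..1} \<times> topspace (nsphere n))"
    by (subst nsphere_eq_top_of_set, simp only: subtopology_Times[symmetric] prod_topology_euclidean)
  have "homotopic_with (\<lambda>_. True) (nsphere n) (nsphere n) g (\<lambda>_. g (\<lambda>i. if i = Suc n then 1 else 0))"
  proof (subst homotopic_with, simp, intro exI conjI ballI allI impI)
    have "continuous_on ({0..1} \<times> topspace (nsphere n)) (g \<circ> h)"
      using hin by (intro continuous_on_compose hc continuous_on_subset [OF g(1)]) auto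
    moreover have "(g \<circ> h) \<in> {0..1} \<times> topspace (nsphere n) \<rightarrow> topspace (nsphere n)"
      using hin g(2) by (auto simp: Pi_iff)
    ultimately show "continuous_map (prod_topology (top_of_set {0..1}) (nsphere n)) (nsphere n) (g \<circ> h)"
      unfolding * by (subst (2) nsphere_eq_top_of_set) (simp add: Pi_iff image_subset_iff)
    show "(g \<circ> h) (0, x) = g x" if "x \<in> topspace (nsphere n)" for x
    proof -
      have "h (0, x) = x" using that by (auto simp: h_def in_nsphere)
      then show ?thesis by simp
    qed
    show "(g \<circ> h) (1, x) = g (\<lambda>i. if i = Suc n then 1 else 0)" if "x \<in> topspace (nsphere n)" for x
    proof -
      have "h (1, x) = (\<lambda>i. if i = Suc n then 1 else 0)" by (auto simp: h_def)
      then show ?thesis by simp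
    qed
  qed auto
  then show ?thesis
    by (rule Brouwer_degree2_nullhomotopic)
qed

text \<open>Induction along the nested spheres: for an odd map that preserves the equator, the
  degrees on the sphere and on the equator have the same parity, so everything comes down to the
  two-point sphere.\<close>

lemma odd_Brouwer_degree2_flag:
  assumes "continuous_map (nsphere n) (nsphere n) g"
    and "\<And>x. x \<in> topspace (nsphere n) \<Longrightarrow> g (\<lambda>i. - x i) = (\<lambda>i. - g x i)"
    and "\<And>k. k < n \<Longrightarrow> g \<in> topspace (nsphere k) \<rightarrow> topspace (nsphere k)"
  shows "odd (Brouwer_degree2 n g)"
  using assms
proof (induction n)
  case 0
  define neg :: "(nat \<Rightarrow> real) \<Rightarrow> nat \<Rightarrow> real" where "neg x = (\<lambda>i. - x i)" for x
  define e :: "nat \<Rightarrow> real" where "e = (\<lambda>i. if i = 0 then 1 else 0)"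
  have S0: "topspace (nsphere 0) = {e, neg e}"
  proof -
    have "x = e \<or> x = neg e" if "x 0 = 1 \<or> x 0 = - 1" "\<forall>i>0. x i = 0" for x :: "nat \<Rightarrow> real"
      using that by (auto simp: e_def neg_def fun_eq_iff)
    then show ?thesis
      by (auto simp: in_nsphere power2_eq_1_iff) (auto simp: e_def neg_def)
  qed
  have neg_neg: "neg (neg x) = x" for x by (simp add: neg_def)
  have ge: "g e \<in> {e, neg e}"
    using 0(1) S0 by (auto simp: continuous_map_nsphere_iff)
  have gn: "g (neg e) = neg (g e)"
    using 0(2)[of e] S0 by (simp add: neg_def)
  \<comment> \<open>An odd self-map of two antipodal points is the identity or the swap, hence an
    involution; its degree therefore squares to 1.\<close>
  have gg: "Brouwer_degree2 0 (g \<circ> g) = Brouwer_degree2 0 id"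
    by (rule Brouwer_degree2_eq) (use S0 ge gn neg_neg in auto)
  have "Brouwer_degree2 0 g * Brouwer_degree2 0 g = 1"
    using Brouwer_degree2_compose[OF 0(1) 0(1)] gg by simp
  then show ?case
    by (metis even_mult_iff odd_one)
next
  case (Suc n)
  have sub: "topspace (nsphere n) \<subseteq> topspace (nsphere (Suc n))"
    by (auto simp: in_nsphere)
  have gn: "g \<in> topspace (nsphere n) \<rightarrow> topspace (nsphere n)"
    using Suc.prems(3)[of n] by simp
  have "odd (Brouwer_degree2 n g)"
    using Suc.prems sub gn
    by (intro Suc.IH) (auto simp: continuous_map_nsphere_iff intro: continuous_on_subset)
  moreover have "even (Brouwer_degree2 (Suc n) g - Brouwer_degree2 (Suc n - Suc 0) g)"
    by (rule Borsuk_odd_mapping_degree_step) (use Suc.prems gn in auto)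
  ultimately show ?case by simp
qed

subsection \<open>The Borsuk-Ulam theorem for the 3-sphere\<close>

lemma in_sphere_R4:
  "(a, b, c, d) \<in> sphere (0 :: real \<times> real \<times> real \<times> real) 1 \<longleftrightarrow> a\<^sup>2 + b\<^sup>2 + c\<^sup>2 + d\<^sup>2 = 1"
  by (simp add: norm_Pair algebra_simps)

text \<open>\<open>C0\<close> and \<open>B0\<close> make the normalised map preserve the circle and
  the pair of poles in it, so its restriction to the 2-sphere has odd degree. Being defined on the
  whole 3-sphere, it also has degree zero there.\<close>

lemma no_nowhere_zero_odd_flag_map:
  fixes A B C :: "real \<times> real \<times> real \<times> real \<Rightarrow> real"
  assumes cont: "continuous_on (sphere 0 1) A" "continuous_on (sphere 0 1) B" "continuous_on (sphere 0 1) C"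
    and odd: "\<And>x. x \<in> sphere 0 1 \<Longrightarrow> A (- x) = - A x"
             "\<And>x. x \<in> sphere 0 1 \<Longrightarrow> B (- x) = - B x"
             "\<And>x. x \<in> sphere 0 1 \<Longrightarrow> C (- x) = - C x"
    and nz: "\<And>x. x \<in> sphere 0 1 \<Longrightarrow> A x \<noteq> 0 \<or> B x \<noteq> 0 \<or> C x \<noteq> 0"
    and C0: "\<And>a b. (a, b, 0 :: real, 0 :: real) \<in> sphere 0 1 \<Longrightarrow> C (a, b, 0, 0) = 0"
    and B0: "B (1, 0, 0, 0) = 0"
  shows False
proof -
  define v :: "(nat \<Rightarrow> real) \<Rightarrow> real \<times> real \<times> real \<times> real" where "v x = (x 0, x 1, x 2, x 3)" for x
  define N where "N p = sqrt ((A p)\<^sup>2 + (B p)\<^sup>2 + (C p)\<^sup>2)" for p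
  \<comment> \<open>The points of \<open>nsphere\<close> are sequences, so the normalised triple is
    padded with zeros.\<close>
  define g :: "(nat \<Rightarrow> real) \<Rightarrow> nat \<Rightarrow> real" where
    "g x i = (if i = 0 then A (v x) / N (v x) else if i = 1 then B (v x) / N (v x)
              else if i = 2 then C (v x) / N (v x) else 0)" for x i
  have N0: "N p \<noteq> 0" if "p \<in> sphere 0 1" for p
    using nz[OF that] by (auto simp: N_def add_nonneg_eq_0_iff)
  have vS: "v x \<in> sphere 0 1" if "x \<in> topspace (nsphere 3)" for x
    using that unfolding v_def in_sphere_R4 by (simp add: in_nsphere eval_nat_numeral)
  have cv: "continuous_on S v" for S
    unfolding v_def by (intro continuous_intros continuous_on_product_coordinates continuous_on_subset[OF continuous_on_product_coordinates]) auto
  have cN: "continuous_on (sphere 0 1) N"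
    unfolding N_def by (intro continuous_intros cont)
  have cg: "continuous_on (topspace (nsphere 3)) g"
  proof (rule continuous_on_coordinatewise_then_product)
    fix i
    have *: "continuous_on (topspace (nsphere 3)) (\<lambda>x. F (v x) / N (v x))"
      if "continuous_on (sphere 0 1) F" for F :: "real \<times> real \<times> real \<times> real \<Rightarrow> real"
    proof -
      have "continuous_on (sphere 0 1) (\<lambda>p. F p / N p)"
        using N0 by (intro continuous_intros that cN) auto
      then show ?thesis
        by (rule continuous_on_compose2) (use cv vS in auto)
    qed
    show "continuous_on (topspace (nsphere 3)) (\<lambda>x. g x i)"
      using *[OF cont(1)] *[OF cont(2)] *[OF cont(3)] by (cases "i \<in> {0, 1, 2}") (auto simp: g_def)
  qed
  have gS: "g x \<in> topspace (nsphere 2)" if "x \<in> topspace (nsphere 3)" for x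
  proof -
    have "(\<Sum>i\<le>2. (g x i)\<^sup>2) = ((A (v x))\<^sup>2 + (B (v x))\<^sup>2 + (C (v x))\<^sup>2) / (N (v x))\<^sup>2"
      by (simp add: g_def eval_nat_numeral power_divide add_divide_distrib)
    also have "\<dots> = 1"
      using N0[OF vS[OF that]] by (simp add: N_def)
    finally show ?thesis by (auto simp: in_nsphere g_def)
  qed
  have cm: "continuous_map (nsphere (Suc 2)) (nsphere 2) g"
    using cg gS cv by (simp add: continuous_map_nsphere_iff Pi_iff eval_nat_numeral)
  have mono: "x \<in> topspace (nsphere n)" if "x \<in> topspace (nsphere m)" "m \<le> n" for x m n
  proof -
    have "(\<Sum>i\<le>n. (x i)\<^sup>2) = (\<Sum>i\<le>m. (x i)\<^sup>2)"
      using that by (intro sum.mono_neutral_right) (auto simp: in_nsphere)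
    with that show ?thesis by (auto simp: in_nsphere)
  qed
  have "odd (Brouwer_degree2 2 g)"
  proof (rule odd_Brouwer_degree2_flag)
    show "continuous_map (nsphere 2) (nsphere 2) g"
      using cm mono[of _ 2 3] unfolding continuous_map_nsphere_iff
      by (auto intro: continuous_on_subset simp: eval_nat_numeral)
    show "g (\<lambda>i. - x i) = (\<lambda>i. - g x i)" if "x \<in> topspace (nsphere 2)" for x
    proof -
      have "v (\<lambda>i. - x i) = - v x" by (simp add: v_def)
      moreover have "v x \<in> sphere 0 1" using vS mono[OF that, of 3] by simp
      ultimately show ?thesis by (simp add: g_def N_def odd fun_eq_iff)
    qed
    show "g \<in> topspace (nsphere k) \<rightarrow> topspace (nsphere k)" if "k < 2" for k
    proof
      fix x assume x: "x \<in> topspace (nsphere k)"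
      have x3: "x \<in> topspace (nsphere 3)" using x that by (auto intro: mono)
      note g2 = gS[OF x3] and vx = vS[OF x3]
      have x23: "x 2 = 0" "x 3 = 0" using x that by (auto simp: in_nsphere)
      have "C (v x) = 0" using vx x23 C0[of "x 0" "x 1"] by (simp only: v_def)
      then have gx2: "g x 2 = 0" by (simp add: g_def)
      show "g x \<in> topspace (nsphere k)"
      \<comment> \<open>A vanishing last coordinate puts a point into the next smaller sphere: one
        such drop reaches the circle, two reach the pair of points.\<close>
      proof (cases "k = 1")
        case True
        then show ?thesis using topspace_nsphere_minus1[OF g2 gx2] by simp
      next
        case False
        then have "k = 0" using that by simp
        then have x0: "(x 0)\<^sup>2 = 1" "x 1 = 0" using x by (auto simp: in_nsphere)
        \<comment> \<open>\<open>B0\<close> speaks of one point only; oddness supplies its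
          antipode.\<close>
        have "B (- 1, 0, 0, 0) = 0" using odd(2)[of "(1, 0, 0, 0)"] B0 unfolding in_sphere_R4 by simp
        then have "B (v x) = 0" using x0 x23 B0 by (auto simp: v_def power2_eq_1_iff)
        then have "g x 1 = 0" by (simp add: g_def)
        then show ?thesis
          using topspace_nsphere_minus1[of "g x" 1] topspace_nsphere_minus1[OF g2 gx2] \<open>k = 0\<close> by simp
      qed
    qed
  qed
  with Brouwer_degree2_extends_hemisphere[OF cm] show False by simp
qed

text \<open>On the circle the first two components alone exclude a zero, so there the third one can
  be damped to nothing, as the flag condition demands.\<close>

lemma no_nowhere_zero_odd_map_if_plane_avoids_axis:
  fixes A B C :: "real \<times> real \<times> real \<times> real \<Rightarrow> real"
  assumes cont: "continuous_on (sphere 0 1) A" "continuous_on (sphere 0 1) B" "continuous_on (sphere 0 1) C"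
    and odd: "\<And>x. x \<in> sphere 0 1 \<Longrightarrow> A (- x) = - A x"
             "\<And>x. x \<in> sphere 0 1 \<Longrightarrow> B (- x) = - B x"
             "\<And>x. x \<in> sphere 0 1 \<Longrightarrow> C (- x) = - C x"
    and nz: "\<And>x. x \<in> sphere 0 1 \<Longrightarrow> A x \<noteq> 0 \<or> B x \<noteq> 0 \<or> C x \<noteq> 0"
    and nz': "\<And>a b. (a, b, 0 :: real, 0 :: real) \<in> sphere 0 1 \<Longrightarrow> A (a, b, 0, 0) \<noteq> 0 \<or> B (a, b, 0, 0) \<noteq> 0"
  shows False
proof -
  let ?e = "(1, 0, 0, 0) :: real \<times> real \<times> real \<times> real"
  define T where "T = sphere (0 :: real \<times> real \<times> real \<times> real) 1 \<inter> {p. fst (snd (snd p)) = 0 \<and> snd (snd (snd p)) = 0}"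
  have T: "(a, b, c, d) \<in> T \<longleftrightarrow> (a, b, 0, 0) \<in> sphere (0 :: real \<times> real \<times> real \<times> real) 1 \<and> c = 0 \<and> d = 0"
    for a b c d
    unfolding T_def by auto
  have e: "?e \<in> T" unfolding T in_sphere_R4 by simp
  have cT: "compact T"
    unfolding T_def by (intro compact_Int_closed compact_sphere closed_Collect_conj closed_Collect_eq continuous_intros)
  \<comment> \<open>The squared distance of the image point from the third axis. By compactness its
    minimum \<open>q m\<close> over the circle is positive and can serve as the damping
    threshold.\<close>
  define q where "q p = (A p)\<^sup>2 + (B p)\<^sup>2" for p
  have cq: "continuous_on (sphere 0 1) q" unfolding q_def by (intro continuous_intros cont)
  then have "continuous_on T q" by (rule continuous_on_subset) (simp add: T_def)
  then obtain m where m: "m \<in> T" "\<And>p. p \<in> T \<Longrightarrow> q m \<le> q p"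
    using continuous_attains_inf[OF cT] e by blast
  have qm: "q m > 0"
    using m(1) nz' by (cases m) (auto simp: T q_def sum_power2_gt_zero_iff simp del: mem_sphere mem_sphere_0)
  define u w where "u = A ?e" and "w = B ?e"
  have uw: "u \<noteq> 0 \<or> w \<noteq> 0" using nz'[of 1 0] unfolding u_def w_def in_sphere_R4 by simp
  \<comment> \<open>Rotate the first two components so that the second one vanishes at the first basis vector,
    and damp the third one so that it vanishes on the circle.\<close>
  define A' B' C' where "A' p = u * A p + w * B p" and "B' p = u * B p - w * A p"
    and "C' p = C p * max 0 (1 - q p / q m)" for p
  \<comment> \<open>In complex notation \<open>A' + i B'\<close> is \<open>A + i B\<close> times the
    conjugate of the nonzero number \<open>u + i w\<close>, so the rotation creates no new
    zero.\<close>
  have AB': "A p = 0 \<and> B p = 0" if "A' p = 0" "B' p = 0" for p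
  proof -
    have "(u\<^sup>2 + w\<^sup>2) * A p = u * A' p - w * B' p" "(u\<^sup>2 + w\<^sup>2) * B p = w * A' p + u * B' p"
      by (simp_all add: A'_def B'_def algebra_simps power2_eq_square)
    moreover have "u\<^sup>2 + w\<^sup>2 \<noteq> 0" using uw by (simp add: sum_power2_eq_zero_iff)
    ultimately show ?thesis using that by auto
  qed
  show False
  proof (rule no_nowhere_zero_odd_flag_map[of A' B' C'])
    show "continuous_on (sphere 0 1) A'" "continuous_on (sphere 0 1) B'" "continuous_on (sphere 0 1) C'"
      unfolding A'_def B'_def C'_def using qm by (intro continuous_intros cont cq; simp)+
    show "A' (- x) = - A' x" "B' (- x) = - B' x" "C' (- x) = - C' x" if "x \<in> sphere 0 1" for x
      using odd[OF that] by (auto simp: A'_def B'_def C'_def q_def algebra_simps)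
    \<comment> \<open>At a common zero of \<open>A'\<close> and \<open>B'\<close> the value of
      \<open>q\<close> is 0, so the damping factor is 1 and \<open>C'\<close> agrees with
      \<open>C\<close>.\<close>
    show "A' x \<noteq> 0 \<or> B' x \<noteq> 0 \<or> C' x \<noteq> 0" if "x \<in> sphere 0 1" for x
      using AB'[of x] nz[OF that] by (auto simp: C'_def q_def)
    show "C' (a, b, 0, 0) = 0" if "(a, b, 0 :: real, 0 :: real) \<in> sphere 0 1" for a b
    proof -
      have "(a, b, 0, 0) \<in> T" using that unfolding T by simp
      then have "q m \<le> q (a, b, 0, 0)" by (rule m(2))
      then show ?thesis using qm by (simp add: C'_def max_def)
    qed
    show "B' (1, 0, 0, 0) = 0" by (simp add: B'_def u_def w_def)
  qed
qed

text \<open>Differentiability rules out space-filling curves: the slopes at which lines through the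
  origin meet the image of the circle form a null set in the plane, so some direction
  \<open>(a, b, 1)\<close> is missed.\<close>

lemma no_nowhere_zero_odd_differentiable_map:
  fixes P :: "real \<times> real \<times> real \<times> real \<Rightarrow> real \<times> real \<times> real"
  assumes diff: "P differentiable_on UNIV"
    and odd: "\<And>x. P (- x) = - P x"
    and nz: "\<And>x. x \<in> sphere 0 1 \<Longrightarrow> P x \<noteq> 0"
  shows False
proof -
  define c :: "real \<Rightarrow> real \<times> real \<times> real \<times> real" where "c t = (cos t, sin t, 0, 0)" for t
  define A B C where "A x = fst (P x)" and "B x = fst (snd (P x))" and "C x = snd (snd (P x))" for x
  have P: "P x = (A x, B x, C x)" for x by (simp add: A_def B_def C_def)
  have dc: "c differentiable (at t)" for t
    unfolding c_def differentiable_def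
    by (rule exI) (rule derivative_eq_intros refl)+
  have dP: "P differentiable (at x)" for x
    using diff unfolding differentiable_on_def by blast
  have d1: "A differentiable (at x)" "B differentiable (at x)" "C differentiable (at x)" for x
  proof -
    obtain D where D: "(P has_derivative D) (at x)"
      using dP[of x] unfolding differentiable_def by blast
    show "A differentiable (at x)" "B differentiable (at x)" "C differentiable (at x)"
      unfolding A_def B_def C_def differentiable_def
      using has_derivative_fst[OF D] has_derivative_fst[OF has_derivative_snd[OF D]]
        has_derivative_snd[OF has_derivative_snd[OF D]] by blast+
  qed
  have dF: "(\<lambda>t. F (c t)) differentiable (at t)" if "\<And>x. F differentiable (at x)" for F :: "_ \<Rightarrow> real" and t
    using differentiable_compose[OF that dc] by simp
  define S where "S = {t. C (c t) \<noteq> 0}"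
  have "(\<lambda>t. (A (c t) / C (c t), B (c t) / C (c t))) differentiable_on S"
    unfolding differentiable_on_def
  proof (intro ballI, rule differentiable_at_withinI, rule differentiable_Pair)
    fix t assume "t \<in> S"
    then have "C (c t) \<noteq> 0" by (simp add: S_def)
    then show "(\<lambda>t. A (c t) / C (c t)) differentiable (at t)" "(\<lambda>t. B (c t) / C (c t)) differentiable (at t)"
      by (auto intro!: differentiable_divide dF[OF d1(1)] dF[OF d1(2)] dF[OF d1(3)])
  qed
  then have "negligible ((\<lambda>t. (A (c t) / C (c t), B (c t) / C (c t))) ` S)"
    by (intro negligible_differentiable_image_lowdim) auto
  then have "(\<lambda>t. (A (c t) / C (c t), B (c t) / C (c t))) ` S \<noteq> UNIV"
    using non_negligible_UNIV by metis
  \<comment> \<open>Shearing by this \<open>(a, b)\<close> moves the image of the circle off the third axis.\<close>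
  then obtain a b where ab: "(a, b) \<notin> (\<lambda>t. (A (c t) / C (c t), B (c t) / C (c t))) ` S"
    by auto
  have cP: "continuous_on X P" for X
    using diff differentiable_imp_continuous_on continuous_on_subset by blast
  have cABC: "continuous_on X A" "continuous_on X B" "continuous_on X C" for X
    unfolding A_def B_def C_def by (intro continuous_intros cP)+
  show False
  proof (rule no_nowhere_zero_odd_map_if_plane_avoids_axis[of "\<lambda>x. A x - a * C x" "\<lambda>x. B x - b * C x" C])
    show "A x - a * C x \<noteq> 0 \<or> B x - b * C x \<noteq> 0 \<or> C x \<noteq> 0" if "x \<in> sphere 0 1" for x
      using nz[OF that] by (auto simp: P zero_prod_def)
    show "A (x, y, 0, 0) - a * C (x, y, 0, 0) \<noteq> 0 \<or> B (x, y, 0, 0) - b * C (x, y, 0, 0) \<noteq> 0"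
      if "(x, y, 0 :: real, 0 :: real) \<in> sphere 0 1" for x y
    proof (rule ccontr)
      assume "\<not> ?thesis"
      then have *: "A (x, y, 0, 0) = a * C (x, y, 0, 0)" "B (x, y, 0, 0) = b * C (x, y, 0, 0)" by auto
      have "x\<^sup>2 + y\<^sup>2 = 1" using that unfolding in_sphere_R4 by simp
      then obtain t where t: "x = cos t" "y = sin t" by (metis sincos_total_2pi)
      \<comment> \<open>If the third component vanished too, \<open>P\<close> would have a zero on
        the sphere. Hence the quotients exist at \<open>t\<close> and would equal the excluded
        pair.\<close>
      have "C (c t) \<noteq> 0" using * nz[OF that] t by (auto simp: P c_def zero_prod_def)
      then have "(a, b) = (A (c t) / C (c t), B (c t) / C (c t))" "t \<in> S"
        using * t by (auto simp: c_def S_def)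
      with ab show False by blast
    qed
  qed (use odd in \<open>auto intro!: continuous_intros cABC simp: P algebra_simps\<close>)
qed

text \<open>Without zeros, \<open>norm f\<close> has a positive minimum on the compact sphere. A
  polynomial map closer to \<open>f\<close> than this minimum has a nowhere vanishing odd part,
  which the differentiable case excludes.\<close>

theorem Borsuk_Ulam_3:
  fixes f :: "real \<times> real \<times> real \<times> real \<Rightarrow> real \<times> real \<times> real"
  assumes cont: "continuous_on (sphere 0 1) f"
    and odd: "\<And>x. x \<in> sphere 0 1 \<Longrightarrow> f (- x) = - f x"
  obtains x where "x \<in> sphere 0 1" "f x = 0"
proof (rule ccontr)
  assume "\<not> thesis"
  with that have nz: "f x \<noteq> 0" if "x \<in> sphere 0 1" for x using \<open>x \<in> sphere 0 1\<close> by blast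
  have "(1, 0, 0, 0) \<in> sphere (0 :: real \<times> real \<times> real \<times> real) 1"
    unfolding in_sphere_R4 by simp
  then obtain m where m: "m \<in> sphere 0 1" "\<And>x. x \<in> sphere 0 1 \<Longrightarrow> norm (f m) \<le> norm (f x)"
    using continuous_attains_inf[OF compact_sphere _ continuous_on_norm[OF cont]] by blast
  have "norm (f m) > 0" using nz m(1) by simp
  from Stone_Weierstrass_polynomial_function[OF compact_sphere cont this]
  obtain g where g: "polynomial_function g" "\<And>x. x \<in> sphere 0 1 \<Longrightarrow> norm (f x - g x) < norm (f m)"
    by auto
  \<comment> \<open>The odd part of \<open>g\<close>. As \<open>f\<close> is its own odd part,
    passing to odd parts does not spoil the uniform error bound.\<close>
  define P where "P x = (1 / 2) *\<^sub>R (g x - g (- x))" for x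
  have dg: "g differentiable (at x)" for x
    using g(1) by (rule differentiable_at_polynomial_function)
  show False
  proof (rule no_nowhere_zero_odd_differentiable_map)
    show "P differentiable_on UNIV"
      unfolding differentiable_on_def P_def
      by (intro ballI differentiable_scaleR differentiable_diff differentiable_const dg differentiable_compose[OF dg] differentiable_minus differentiable_ident)
    show "P (- x) = - P x" for x by (simp add: P_def flip: scaleR_minus_right)
    show "P x \<noteq> 0" if "x \<in> sphere 0 1" for x
    proof
      assume "P x = 0"
      then have "2 *\<^sub>R f x = (f x - g x) - (f (- x) - g (- x))"
        using odd[OF that] by (simp add: P_def scaleR_2)
      then have "2 * norm (f x) \<le> norm (f x - g x) + norm (f (- x) - g (- x))"
        by (metis norm_scaleR norm_triangle_ineq4 abs_numeral)
      also have "\<dots> < norm (f m) + norm (f m)"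
        using g(2)[of x] g(2)[of "- x"] that by (intro add_strict_mono) auto
      finally show False using m(2)[OF that] by simp
    qed
  qed
qed

subsection \<open>Sign regions of trigonometric forms\<close>

definition trig :: "real \<Rightarrow> real \<times> real \<times> real \<times> real \<Rightarrow> real \<times> real \<Rightarrow> real" where
  "trig \<alpha> = (\<lambda>(a, b, c, d) (x, y). a * cos (2 * pi * x / \<alpha>) + b * sin (2 * pi * x / \<alpha>) + c * y + d)"

lemma trig_uminus: "trig \<alpha> (- v) p = - trig \<alpha> v p"
  by (cases v; cases p) (simp add: trig_def)

lemma continuous_on_trig_point [continuous_intros]: "continuous_on S (trig \<alpha> v)"
  by (cases "\<alpha> = 0") (auto simp: trig_def case_prod_beta intro!: continuous_intros)

lemma continuous_on_trig_coeff [continuous_intros]: "continuous_on S (\<lambda>v. trig \<alpha> v p)"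
  by (auto simp: trig_def case_prod_beta intro!: continuous_intros)

lemma borel_measurable_trig [measurable]: "trig \<alpha> v \<in> borel_measurable borel"
  by (intro borel_measurable_continuous_onI continuous_intros)

text \<open>\<open>arccos (cos u)\<close> is the distance from \<open>u\<close> to the nearest
  multiple of \<open>2 * pi\<close>, and cosine decreases strictly on \<open>{0..pi}\<close>. This
  turns a sign condition into a union of intervals.\<close>

lemma cos_less_cos_iff:
  assumes "0 \<le> \<theta>" "\<theta> \<le> pi"
  shows "cos \<theta> < cos u \<longleftrightarrow> (\<exists>n::int. \<bar>u - 2 * pi * of_int n\<bar> < \<theta>)"
proof
  assume "cos \<theta> < cos u"
  obtain n :: int where "arccos (cos u) = \<bar>u - of_int n * (2 * pi)\<bar>"
    by (rule arccos_cos_eq_abs_2pi)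
  moreover have "arccos (cos u) < arccos (cos \<theta>)"
    using \<open>cos \<theta> < cos u\<close> by (intro arccos_less_arccos) auto
  ultimately show "\<exists>n::int. \<bar>u - 2 * pi * of_int n\<bar> < \<theta>"
    using assms by (intro exI[of _ n]) (simp add: arccos_cos mult.commute)
next
  assume "\<exists>n::int. \<bar>u - 2 * pi * of_int n\<bar> < \<theta>"
  then obtain n :: int where n: "\<bar>u - 2 * pi * of_int n\<bar> < \<theta>" ..
  have "cos u = cos \<bar>u - 2 * pi * of_int n\<bar>"
    by (simp add: cos_diff)
  then show "cos \<theta> < cos u"
    using n assms cos_mono_less_eq[of "\<theta>" "\<bar>u - 2 * pi * of_int n\<bar>"] by simp
qed

lemma countable_cos_eq: "countable {u :: real. cos u = k}"
proof (rule countable_subset)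
  show "{u. cos u = k} \<subseteq> range (\<lambda>n. of_int n * (2 * pi) + arccos k) \<union> range (\<lambda>n. of_int n * (2 * pi) - arccos k)"
  proof
    fix u assume "u \<in> {u. cos u = k}"
    moreover obtain n :: int where "arccos (cos u) = \<bar>u - of_int n * (2 * pi)\<bar>"
      by (rule arccos_cos_eq_abs_2pi)
    ultimately have "u = of_int n * (2 * pi) + arccos k \<or> u = of_int n * (2 * pi) - arccos k"
      by auto
    then show "u \<in> range (\<lambda>n. of_int n * (2 * pi) + arccos k) \<union> range (\<lambda>n. of_int n * (2 * pi) - arccos k)"
      by blast
  qed
qed auto

lemma cos_sin_polar:
  fixes a b :: real
  obtains r t0 where "r \<ge> 0" "\<forall>u. a * cos u + b * sin u = r * cos (u - t0)" "a\<^sup>2 + b\<^sup>2 = r\<^sup>2"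
proof -
  obtain r t where rt: "a = r * cos t" "b = r * sin t" using polar_Ex by blast
  have sq: "a\<^sup>2 + b\<^sup>2 = r\<^sup>2"
    unfolding rt by (simp add: power_mult_distrib flip: distrib_left)
  show thesis
  proof (cases "r \<ge> 0")
    case True
    show thesis by (rule that[of r t]) (use True sq in \<open>auto simp: rt cos_diff algebra_simps\<close>)
  next
    case False
    \<comment> \<open>A negative amplitude is absorbed by a half-turn of the phase.\<close>
    show thesis by (rule that[of "- r" "t + pi"]) (use False sq in \<open>auto simp: rt cos_diff algebra_simps\<close>)
  qed
qed

lemma countable_trig_zeros:
  assumes "\<alpha> > 0" "a \<noteq> 0 \<or> b \<noteq> 0"
  shows "countable {x. a * cos (2 * pi * x / \<alpha>) + b * sin (2 * pi * x / \<alpha>) + d = 0}"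
proof -
  obtain r t0 where "r \<ge> 0" and r: "\<forall>u. a * cos u + b * sin u = r * cos (u - t0)"
      "a\<^sup>2 + b\<^sup>2 = r\<^sup>2"
    by (rule cos_sin_polar[where a = a and b = b])
  have "r \<noteq> 0" using r(2) assms(2) by (auto simp: sum_power2_eq_zero_iff)
  have "{x. a * cos (2 * pi * x / \<alpha>) + b * sin (2 * pi * x / \<alpha>) + d = 0}
      \<subseteq> (\<lambda>u. \<alpha> / (2 * pi) * (u + t0)) ` {u. cos u = - d / r}"
  proof
    fix x assume x: "x \<in> {x. a * cos (2 * pi * x / \<alpha>) + b * sin (2 * pi * x / \<alpha>) + d = 0}"
    show "x \<in> (\<lambda>u. \<alpha> / (2 * pi) * (u + t0)) ` {u. cos u = - d / r}"
      by (rule image_eqI[of _ _ "2 * pi * x / \<alpha> - t0"])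
         (use x \<open>r \<noteq> 0\<close> assms(1) in \<open>auto simp: r(1) field_simps\<close>)
  qed
  then show ?thesis
    using countable_cos_eq countable_image countable_subset by blast
qed

text \<open>By Fubini it is enough that the zero set has countable slices. If \<open>c\<close> is
  nonzero, each vertical slice has at most one point; otherwise the horizontal slices are zero sets
  of a trigonometric function, empty when only \<open>d\<close> is left.\<close>

lemma AE_trig_nonzero:
  assumes "\<alpha> > 0" "v \<noteq> 0"
  shows "AE p in lborel. trig \<alpha> v p \<noteq> 0"
proof -
  obtain a b c d where v: "v = (a, b, c, d)" by (cases v)
  have meas: "{p \<in> space (lborel \<Otimes>\<^sub>M lborel). trig \<alpha> v p \<noteq> 0} \<in> sets (lborel \<Otimes>\<^sub>M lborel)"
    unfolding lborel_prod by measurable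
  have "AE x in lborel. AE y in lborel. trig \<alpha> v (x, y) \<noteq> 0"
  proof (cases "c = 0")
    case False
    show ?thesis
    proof (rule AE_I2)
      fix x :: real
      have "countable {y. \<not> trig \<alpha> v (x, y) \<noteq> 0}"
        by (rule countable_subset[of _ "{- (a * cos (2 * pi * x / \<alpha>) + b * sin (2 * pi * x / \<alpha>) + d) / c}"])
           (use False in \<open>auto simp: v trig_def field_simps eq_neg_iff_add_eq_0\<close>)
      then show "AE y in lborel. trig \<alpha> v (x, y) \<noteq> 0"
        by (intro AE_I'[OF countable_imp_null_set_lborel]) auto
    qed
  next
    case True
    have "countable {x. \<not> trig \<alpha> v (x, y) \<noteq> 0}" for y
    proof (cases "a \<noteq> 0 \<or> b \<noteq> 0")
      case True
      with \<open>c = 0\<close> show ?thesis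
        using countable_trig_zeros[OF assms(1), of a b d] by (simp add: v trig_def)
    next
      case False
      with \<open>c = 0\<close> assms(2) show ?thesis by (simp add: v trig_def zero_prod_def)
    qed
    then have "AE x in lborel. trig \<alpha> v (x, y) \<noteq> 0" for y
      by (intro AE_I'[OF countable_imp_null_set_lborel[of "{x. \<not> trig \<alpha> v (x, y) \<noteq> 0}"]]) auto
    then have "AE y in lborel. AE x in lborel. trig \<alpha> v (x, y) \<noteq> 0"
      by simp
    then show ?thesis
      by (subst lborel_pair.AE_commute) (use meas in simp_all)
  qed
  then have "AE p in lborel \<Otimes>\<^sub>M lborel. trig \<alpha> v p \<noteq> 0"
    by (intro lborel_pair.AE_pair_measure[OF meas])
  then show ?thesis by (simp only: lborel_prod)
qed

section \<open>Measures of the sign regions and the imbalance map\<close>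

locale ac_plane_measure = finite_measure M for M :: "(real \<times> real) measure" +
  fixes \<alpha> :: real
  assumes \<alpha>: "\<alpha> > 0"
    and sets_M [measurable_cong]: "sets M = sets borel"
    and ac: "absolutely_continuous lborel M"
begin

lemma space_M: "space M = UNIV"
  using sets_eq_imp_space_eq[OF sets_M] by simp

lemma AE_nonzero: "v \<noteq> 0 \<Longrightarrow> AE p in M. trig \<alpha> v p \<noteq> 0"
  by (rule absolutely_continuous_AE[OF _ ac AE_trig_nonzero[OF \<alpha>]]) (simp_all add: sets_M)

text \<open>The measure of the positive side minus that of the negative side, written as one
  integral so that dominated convergence applies.\<close>

definition imbalance :: "real \<times> real \<times> real \<times> real \<Rightarrow> real" where
  "imbalance v = (\<integral>p. sgn (trig \<alpha> v p) \<partial>M)"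

lemma imbalance_uminus: "imbalance (- v) = - imbalance v"
  by (simp add: imbalance_def trig_uminus sgn_minus)

text \<open>\<open>sgn\<close> is continuous away from 0, and the limit form is nonzero almost
  everywhere by absolute continuity. So the integrands converge almost everywhere, dominated by the
  constant 1, which is integrable for a finite measure.\<close>

lemma continuous_on_imbalance: "continuous_on (sphere 0 1) imbalance"
proof (rule continuous_on_sequentiallyI)
  fix v and l :: "real \<times> real \<times> real \<times> real"
  assume v: "l \<in> sphere 0 1" "v \<longlonglongrightarrow> l"
  show "(\<lambda>n. imbalance (v n)) \<longlonglongrightarrow> imbalance l"
    unfolding imbalance_def
  proof (rule integral_dominated_convergence[where w = "\<lambda>_. 1"])
    have "l \<noteq> 0" using v(1) by auto
    show "AE p in M. (\<lambda>n. sgn (trig \<alpha> (v n) p)) \<longlonglongrightarrow> sgn (trig \<alpha> l p)"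
      using AE_nonzero[OF \<open>l \<noteq> 0\<close>]
    proof eventually_elim
      case (elim p)
      have "isCont (\<lambda>v. trig \<alpha> v p) l"
        using continuous_on_trig_coeff[of UNIV] continuous_on_eq_continuous_at by blast
      then show ?case
        using elim by (intro tendsto_sgn isCont_tendsto_compose[OF _ v(2)])
    qed
  qed (auto simp: sgn_if)
qed

text \<open>The two sides fill the plane up to a null set, so their measures have a known sum and a
  known difference. At a zero of the imbalance both are half the total.\<close>

lemma measure_positive_negative:
  assumes "v \<noteq> 0"
  shows "measure M {p. trig \<alpha> v p > 0} = (measure M UNIV + imbalance v) / 2"
    and "measure M {p. trig \<alpha> v p < 0} = (measure M UNIV - imbalance v) / 2"
proof -
  let ?P = "{p. trig \<alpha> v p > 0}" and ?N = "{p. trig \<alpha> v p < 0}"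
  have [measurable]: "?P \<in> sets M" "?N \<in> sets M" by measurable
  have "imbalance v = (\<integral>p. indicator ?P p - indicator ?N p \<partial>M)"
    unfolding imbalance_def by (intro Bochner_Integration.integral_cong) (auto simp: sgn_if indicator_def)
  also have "\<dots> = measure M ?P - measure M ?N"
    by (subst Bochner_Integration.integral_diff) (auto simp: emeasure_finite less_top[symmetric] space_M)
  finally have 1: "imbalance v = measure M ?P - measure M ?N" .
  have "measure M UNIV = measure M (?P \<union> ?N)"
    by (rule measure_eq_AE) (use AE_nonzero[OF assms] in \<open>auto simp: space_M[symmetric] neq_iff elim!: eventually_mono\<close>)
  also have "\<dots> = measure M ?P + measure M ?N"
    by (rule finite_measure_Union) auto
  finally show "measure M ?P = (measure M UNIV + imbalance v) / 2"
    "measure M ?N = (measure M UNIV - imbalance v) / 2" using 1 by auto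
qed

end

subsection \<open>Sign regions as sides of sine waves\<close>

lemma inner_strips_shift:
  "inner_strips \<alpha> (a + of_int m * \<alpha>) (b + of_int m * \<alpha>) = inner_strips \<alpha> a b" (is "?L = ?R")
proof
  show "?L \<subseteq> ?R"
  proof
    fix p assume "p \<in> ?L"
    then obtain x y and n :: int where "p = (x, y)" "of_int n * \<alpha> + (a + of_int m * \<alpha>) < x" "x < of_int n * \<alpha> + (b + of_int m * \<alpha>)"
      by (auto simp: inner_strips_def)
    then show "p \<in> ?R" unfolding inner_strips_def
      by (intro UN_I[of "n + m"]) (auto simp: algebra_simps)
  qed
  show "?R \<subseteq> ?L"
  proof
    fix p assume "p \<in> ?R"
    then obtain x y and n :: int where "p = (x, y)" "of_int n * \<alpha> + a < x" "x < of_int n * \<alpha> + b"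
      by (auto simp: inner_strips_def)
    then show "p \<in> ?L" unfolding inner_strips_def
      by (intro UN_I[of "n - m"]) (auto simp: algebra_simps)
  qed
qed

text \<open>With both colours expressed through \<open>inner_strips\<close>, the two families of
  lines can exchange roles.\<close>

lemma outer_strips_eq: "outer_strips \<alpha> a b = inner_strips \<alpha> b (a + \<alpha>)"
  by (simp add: outer_strips_def inner_strips_def algebra_simps)

text \<open>Translating by a multiple of the period brings \<open>p\<close> into the fundamental
  interval, but \<open>q\<close> may then lie beyond its end. In that case the previous copy of
  \<open>q\<close> becomes the left line and the colours swap, whence the disjunction.\<close>

lemma divides_strips:
  assumes "\<alpha> > 0" "p < q" "q < p + \<alpha>"
  shows "\<exists>W. divides \<alpha> W (inner_strips \<alpha> p q) (inner_strips \<alpha> q (p + \<alpha>)) \<or>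
             divides \<alpha> W (inner_strips \<alpha> q (p + \<alpha>)) (inner_strips \<alpha> p q)"
proof -
  define m where "m = \<lfloor>p / \<alpha>\<rfloor>"
  define p' q' where "p' = p - of_int m * \<alpha>" and "q' = q - of_int m * \<alpha>"
  have "of_int m \<le> p / \<alpha>" "p / \<alpha> < of_int m + 1" unfolding m_def by linarith+
  then have p': "0 \<le> p'" "p' < \<alpha>" using assms(1) by (simp_all add: p'_def field_simps)
  have q': "p' < q'" "q' < p' + \<alpha>" using assms(2,3) by (simp_all add: p'_def q'_def)
  have eq: "inner_strips \<alpha> p q = inner_strips \<alpha> p' q'"
    "inner_strips \<alpha> q (p + \<alpha>) = inner_strips \<alpha> q' (p' + \<alpha>)"
    using inner_strips_shift[of \<alpha> p' m q'] inner_strips_shift[of \<alpha> q' m "p' + \<alpha>"]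
    by (simp_all add: p'_def q'_def algebra_simps)
  show ?thesis
  proof (cases "q' < \<alpha>")
    case True
    from divides.degenerate[OF p'(1) q'(1) this] show ?thesis
      unfolding eq outer_strips_eq by blast
  next
    case False
    \<comment> \<open>This case includes \<open>q' = \<alpha>\<close>, where the left line becomes
      0.\<close>
    then have "0 \<le> q' - \<alpha>" "q' - \<alpha> < p'" using q' by auto
    from divides.degenerate[OF this p'(2)]
    have "divides \<alpha> (degenerate_sine_wave \<alpha> (q' - \<alpha>) p') (inner_strips \<alpha> (q' - \<alpha>) p') (inner_strips \<alpha> p' q')"
      by (simp add: outer_strips_eq)
    moreover have "inner_strips \<alpha> (q' - \<alpha>) p' = inner_strips \<alpha> q' (p' + \<alpha>)"
      using inner_strips_shift[of \<alpha> "q' - \<alpha>" 1 p'] by simp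
    ultimately show ?thesis unfolding eq by auto
  qed
qed

text \<open>The strict bound on \<open>d\<close> gives \<open>- d / r = cos \<theta>\<close> with
  \<open>\<theta>\<close> strictly between 0 and \<open>pi\<close>. The positive set then consists
  of strips of half-width \<open>\<theta>\<close> in phase around the maxima of the cosine, and the
  negative set of the open gaps.\<close>

lemma divides_vertical:
  assumes "\<alpha> > 0" "r > 0" "\<bar>d\<bar> < r"
  shows "\<exists>W. let P = {(x, y). r * cos (2 * pi * x / \<alpha> - t0) + d > 0};
                 N = {(x, y). r * cos (2 * pi * x / \<alpha> - t0) + d < 0}
             in divides \<alpha> W P N \<or> divides \<alpha> W N P"
proof -
  define \<theta> where "\<theta> = arccos (- d / r)"
  have k: "- 1 < - d / r" "- d / r < 1" using assms by (auto simp: field_simps abs_less_iff)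
  have \<theta>: "0 < \<theta>" "\<theta> < pi" "cos \<theta> = - d / r"
    using arccos_lt_bounded[OF k] k by (auto simp: \<theta>_def)
  have d: "d = - r * cos \<theta>" using \<theta>(3) assms by simp
  define w where "w = \<alpha> / (2 * pi)"
  have w: "w > 0" using assms by (simp add: w_def)
  \<comment> \<open>The positions at which the phase \<open>2 * pi * x / \<alpha>\<close> equals
    \<open>t0 - \<theta>\<close> and \<open>t0 + \<theta>\<close>.\<close>
  define p q where "p = w * (t0 - \<theta>)" and "q = w * (t0 + \<theta>)"
  have \<alpha>w: "\<alpha> = w * (2 * pi)" by (simp add: w_def)
  have u: "2 * pi * x / \<alpha> = x / w" for x using assms(1) by (simp add: w_def)
  have sgn: "r * cos u + d > 0 \<longleftrightarrow> cos u > cos \<theta>" "r * cos u + d < 0 \<longleftrightarrow> cos u < cos \<theta>" for u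
    using assms(2) by (auto simp: d)
  have inner: "(x, y) \<in> inner_strips \<alpha> p q \<longleftrightarrow> (\<exists>n::int. \<bar>x / w - t0 - 2 * pi * of_int n\<bar> < \<theta>)" for x y
  proof -
    have "of_int n * \<alpha> + p < x \<and> x < of_int n * \<alpha> + q \<longleftrightarrow> \<bar>x / w - t0 - 2 * pi * of_int n\<bar> < \<theta>" for n :: int
      using w unfolding \<alpha>w p_def q_def by (auto simp: field_simps abs_less_iff)
    then show ?thesis by (auto simp: inner_strips_def)
  qed
  have outer: "(x, y) \<in> inner_strips \<alpha> q (p + \<alpha>) \<longleftrightarrow>
      (\<exists>n::int. \<theta> < x / w - t0 - 2 * pi * of_int n \<and> x / w - t0 - 2 * pi * of_int n < 2 * pi - \<theta>)" for x y
  proof -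
    have "of_int n * \<alpha> + q < x \<and> x < of_int n * \<alpha> + (p + \<alpha>) \<longleftrightarrow>
      \<theta> < x / w - t0 - 2 * pi * of_int n \<and> x / w - t0 - 2 * pi * of_int n < 2 * pi - \<theta>" for n :: int
      using w unfolding \<alpha>w p_def q_def by (auto simp: field_simps)
    then show ?thesis by (auto simp: inner_strips_def)
  qed
  have pos: "cos u > cos \<theta> \<longleftrightarrow> (\<exists>n::int. \<bar>u - 2 * pi * of_int n\<bar> < \<theta>)" for u
    by (rule cos_less_cos_iff) (use \<theta> in auto)
  have neg: "cos u < cos \<theta> \<longleftrightarrow> (\<exists>n::int. \<theta> < u - 2 * pi * of_int n \<and> u - 2 * pi * of_int n < 2 * pi - \<theta>)" for u
  proof -
    \<comment> \<open>A half-turn exchanges the signs and replaces \<open>\<theta>\<close> by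
      \<open>pi - \<theta>\<close>, so the criterion for the positive set also yields the negative
      one.\<close>
    have "cos u < cos \<theta> \<longleftrightarrow> cos (u - pi) > cos (pi - \<theta>)" by (simp add: cos_diff)
    also have "\<dots> \<longleftrightarrow> (\<exists>n::int. \<bar>u - pi - 2 * pi * of_int n\<bar> < pi - \<theta>)"
      using \<theta> by (intro cos_less_cos_iff) auto
    also have "\<dots> \<longleftrightarrow> (\<exists>n::int. \<theta> < u - 2 * pi * of_int n \<and> u - 2 * pi * of_int n < 2 * pi - \<theta>)"
      by (intro ex_cong1) (auto simp: abs_less_iff)
    finally show ?thesis .
  qed
  have "{(x, y). r * cos (2 * pi * x / \<alpha> - t0) + d > 0} = inner_strips \<alpha> p q"
    "{(x, y). r * cos (2 * pi * x / \<alpha> - t0) + d < 0} = inner_strips \<alpha> q (p + \<alpha>)"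
    by (auto simp: inner outer sgn pos neg u)
  moreover have "p < q" "q < p + \<alpha>"
    using w \<theta> by (auto simp: p_def q_def \<alpha>w simp flip: distrib_left)
  ultimately show ?thesis
    using divides_strips[OF assms(1), of p q] by (simp add: Let_def)
qed

text \<open>Solving for \<open>y\<close> factors the form as \<open>c\<close> times the height above
  a wave, with amplitude and phase from polar coordinates of \<open>(- b / c, - a / c)\<close>. The
  sign of \<open>c\<close> decides which side is positive.\<close>

lemma divides_trig_graph:
  assumes "c \<noteq> 0"
  shows "\<exists>W. let P = {p. trig \<alpha> (a, b, c, d) p > 0}; N = {p. trig \<alpha> (a, b, c, d) p < 0}
             in divides \<alpha> W P N \<or> divides \<alpha> W N P"
proof -
  obtain A s where As: "- a / c = A * sin s" "- b / c = A * cos s"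
    using polar_Ex[of "- b / c" "- a / c"] by blast
  define r where "r = - d / c"
  have *: "trig \<alpha> (a, b, c, d) (x, y) = c * (y - (r + A * sin (2 * pi * x / \<alpha> + s)))" for x y
  proof -
    have "a = - c * (A * sin s)" "b = - c * (A * cos s)" "d = - c * r"
      using assms by (simp_all add: As[symmetric] r_def)
    then show ?thesis
      by (simp add: trig_def sin_add algebra_simps)
  qed
  show ?thesis
  proof (cases "c > 0")
    case True
    then have "{p. trig \<alpha> (a, b, c, d) p > 0} = above_sine_wave \<alpha> A r s"
      "{p. trig \<alpha> (a, b, c, d) p < 0} = below_sine_wave \<alpha> A r s"
      by (auto simp: * above_sine_wave_def below_sine_wave_def zero_less_mult_iff mult_less_0_iff)
    then show ?thesis using divides.proper[of \<alpha> A r s] by (auto simp: Let_def)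
  next
    case False
    then have "{p. trig \<alpha> (a, b, c, d) p < 0} = above_sine_wave \<alpha> A r s"
      "{p. trig \<alpha> (a, b, c, d) p > 0} = below_sine_wave \<alpha> A r s"
      using assms by (auto simp: * above_sine_wave_def below_sine_wave_def zero_less_mult_iff mult_less_0_iff)
    then show ?thesis using divides.proper[of \<alpha> A r s] by (auto simp: Let_def)
  qed
qed

section \<open>Halving three measures at a common zero of their imbalances\<close>

theorem theorem2p2:
  fixes \<alpha> :: real and \<mu> :: "nat \<Rightarrow> (real \<times> real) measure"
  assumes "\<alpha> > 0"
    and "\<And>i. i \<in> {1, 2, 3} \<Longrightarrow> sets (\<mu> i) = sets borel"
    and "\<And>i. i \<in> {1, 2, 3} \<Longrightarrow> finite_measure (\<mu> i)"
    and "\<And>i. i \<in> {1, 2, 3} \<Longrightarrow> absolutely_continuous lborel (\<mu> i)"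
  shows "\<exists>W U V. divides \<alpha> W U V \<and>
    (\<forall>i\<in>{1, 2, 3}. measure (\<mu> i) U = measure (\<mu> i) UNIV / 2 \<and>
                   measure (\<mu> i) V = measure (\<mu> i) UNIV / 2)"
proof -
  have \<mu>: "ac_plane_measure (\<mu> i) \<alpha>" if "i \<in> {1, 2, 3}" for i
    using assms that by (simp add: ac_plane_measure_def ac_plane_measure_axioms_def)
  define F where "F i = ac_plane_measure.imbalance (\<mu> i) \<alpha>" for i
  have Fc: "continuous_on (sphere 0 1) (F i)" and Fm: "F i (- v) = - F i v" if "i \<in> {1, 2, 3}" for i v
    unfolding F_def using ac_plane_measure.continuous_on_imbalance ac_plane_measure.imbalance_uminus \<mu> that by blast+
  obtain v where v: "v \<in> sphere 0 1" "(F 1 v, F 2 v, F 3 v) = 0"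
    by (rule Borsuk_Ulam_3[of "\<lambda>v. (F 1 v, F 2 v, F 3 v)"]) (auto intro!: continuous_intros Fc simp: Fm)
  have v0: "v \<noteq> 0" using v(1) by auto
  have F0: "F i v = 0" if "i \<in> {1, 2, 3}" for i
    using v(2) that by (auto simp: zero_prod_def)
  let ?P = "{p. trig \<alpha> v p > 0}" and ?N = "{p. trig \<alpha> v p < 0}"
  have half: "measure (\<mu> i) ?P = measure (\<mu> i) UNIV / 2" "measure (\<mu> i) ?N = measure (\<mu> i) UNIV / 2"
    if "i \<in> {1, 2, 3}" for i
    using ac_plane_measure.measure_positive_negative[OF \<mu>[OF that] v0] F0[OF that] by (auto simp: F_def)
  show ?thesis
  proof (cases "?P = {} \<or> ?N = {}")
    case True
    then have "measure (\<mu> i) UNIV = 0" if "i \<in> {1, 2, 3}" for i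
      using half[OF that] True by (metis field_sum_of_halves measure_empty add_0)
    moreover have "measure (\<mu> i) X \<le> measure (\<mu> i) UNIV" if "i \<in> {1, 2, 3}" for i X
      using finite_measure.bounded_measure[OF assms(3)[OF that], of X] sets_eq_imp_space_eq[OF assms(2)[OF that]] by simp
    ultimately have "measure (\<mu> i) X = 0" if "i \<in> {1, 2, 3}" for i X
      using that by (metis measure_le_0_iff)
    \<comment> \<open>All three measures being zero, any wave halves them; the choice is the flat
      one along the x-axis.\<close>
    then show ?thesis using divides.proper[of \<alpha> 0 0 0] by (metis div_0)
  next
    case False
    obtain a b c d where abcd: "v = (a, b, c, d)" by (cases v)
    have "\<exists>W. divides \<alpha> W ?P ?N \<or> divides \<alpha> W ?N ?P"
    proof (cases "c = 0")
      case False
      then show ?thesis using divides_trig_graph[of c \<alpha> a b d] by (simp add: Let_def abcd)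
    next
      case True
      obtain r t0 where r: "r \<ge> 0" "\<forall>u. a * cos u + b * sin u = r * cos (u - t0)"
          "a\<^sup>2 + b\<^sup>2 = r\<^sup>2"
        by (rule cos_sin_polar[where a = a and b = b])
      have t: "trig \<alpha> v = (\<lambda>(x, y). r * cos (2 * pi * x / \<alpha> - t0) + d)"
        using True by (auto simp: abcd trig_def r(2) fun_eq_iff)
      have bd: "\<bar>r * cos u\<bar> \<le> r" for u
        using r(1) by (simp add: abs_mult mult_left_le)
      \<comment> \<open>Both signs occur, so the cosine term, of size at most \<open>r\<close>,
        strictly exceeds \<open>d\<close> in both directions.\<close>
      have "\<bar>d\<bar> < r"
      proof -
        from \<open>\<not> (?P = {} \<or> ?N = {})\<close> obtain u u' where "r * cos u + d > 0" "r * cos u' + d < 0"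
          by (auto simp: t)
        then show ?thesis using bd[of u] bd[of u'] by linarith
      qed
      then show ?thesis
        using divides_vertical[OF assms(1), of r d t0] by (auto simp: Let_def t case_prod_unfold)
    qed
    then obtain W where "divides \<alpha> W ?P ?N \<or> divides \<alpha> W ?N ?P" ..
    then show ?thesis
    proof
      assume "divides \<alpha> W ?P ?N"
      then show ?thesis by (intro exI[of _ W] exI[of _ ?P] exI[of _ ?N] conjI ballI half)
    next
      assume "divides \<alpha> W ?N ?P"
      then show ?thesis by (intro exI[of _ W] exI[of _ ?N] exI[of _ ?P] conjI ballI half)
    qed
  qed
qed

end
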